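(* Let $\tau>0$ and $A\in\mathbb{R}^{m\times n}$. Suppose only player 2 follows the entropy-regularized OMWU method, while the policies $\bar\mu^{(0)},\bar\mu^{(1)},\dots\in\Delta(\mathcal{A})$ of player 1 are arbitrary (possibly adversarial). That is, player 2 starts from the uniform policy $\nu^{(0)}(b)=\bar\nu^{(0)}(b)=1/|\mathcal{B}|$ for all $b\in\mathcal{B}$ and, for $t\ge0$, updates $$\bar\nu^{(t+1)}(b)\propto\nu^{(t)}(b)^{1-\eta_t\tau}\exp(-\eta_t[A^\top\bar\mu^{(t)}]_b),\qquad\nu^{(t+1)}(b)\propto\nu^{(t)}(b)^{1-\eta_t\tau}\exp(-\eta_t[A^\top\bar\mu^{(t+1)}]_b),$$ with learning rate $\eta_t=\frac{1}{(t+1)\tau}$. Then for every integer $T\ge1$ and every sequence $\{A^\top\bar\mu^{(t)}\}_{t=0}^T$ of play, $$\mathsf{Regret}_\lambda(T)\le\tau^{-1}(\log T+1)\left(\tau\log|\mathcal{B}|+5\|A\|_\infty\right)^2+4\|A\|_\infty.$$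
   Context: $\mathcal{A}=\{1,\dots,m\}$, $\mathcal{B}=\{1,\dots,n\}$; $\Delta(\cdot)$ denotes the probability simplex; $\|A\|_\infty=\max_{i,j}|A_{i,j}|$; $\mathcal{H}(\pi)=-\sum_i\pi_i\log\pi_i$. The symbol $\propto$ means normalization to a probability vector. For each $t$ put $$f_\tau^{(t)}(\nu)=\bar\mu^{(t)\top}A\nu+\tau\mathcal{H}(\bar\mu^{(t)})-\tau\mathcal{H}(\nu),\qquad\nu\in\Delta(\mathcal{B}),$$ and define the regret of player 2 by $$\mathsf{Regret}_\lambda(T)=\sum_{t=0}^Tf_\tau^{(t)}(\bar\nu^{(t)})-\min_{\nu\in\Delta(\mathcal{B})}\sum_{t=0}^Tf_\tau^{(t)}(\nu)$$ (the subscript $\lambda$ is just notation for the regret of the game regularized with parameter $\tau$). *)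

theory Defs
  imports "HOL-Analysis.Analysis" "HOL-Real_Asymp.Real_Asymp"
begin

text \<open>The action sets \<open>{1..m}\<close> and \<open>{1..n}\<close> are the finite index types \<open>'m\<close> and \<open>'n\<close>;
  \<open>A $ a $ b\<close> is the entry in row \<open>a\<close> and column \<open>b\<close>.\<close>

definition prob_simplex :: "(real ^ 'k::finite) set" where
  "prob_simplex = {x. (\<forall>i. 0 \<le> x $ i) \<and> (\<Sum>i\<in>UNIV. x $ i) = 1}"

definition max_abs_entry :: "real ^ 'n::finite ^ 'm::finite \<Rightarrow> real" where
  "max_abs_entry A = Max {\<bar>A $ i $ j\<bar> | i j. True}"

text \<open>The convention \<open>0 log 0 = 0\<close> holds because the value of \<^term>\<open>ln 0 :: real\<close> is multiplied by 0.\<close>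

definition shannon_entropy :: "real ^ 'k::finite \<Rightarrow> real" where
  "shannon_entropy p = - (\<Sum>i\<in>UNIV. p $ i * ln (p $ i))"

text \<open>\<open>p \<propto> w\<close> is rendered as \<open>p = normalize_weights w\<close>; it is only used for positive weights.\<close>

definition normalize_weights :: "('k::finite \<Rightarrow> real) \<Rightarrow> real ^ 'k" where
  "normalize_weights w = (\<chi> i. w i / (\<Sum>j\<in>UNIV. w j))"

definition reg_loss ::
  "real \<Rightarrow> real ^ 'n::finite ^ 'm::finite \<Rightarrow> real ^ 'm \<Rightarrow> real ^ 'n \<Rightarrow> real" where
  "reg_loss \<tau> A \<mu> \<nu> = \<mu> \<bullet> (A *v \<nu>) + \<tau> * shannon_entropy \<mu> - \<tau> * shannon_entropy \<nu>"

text \<open>The infimum below is a minimum for every sequence \<open>\<mu>\<close>: see \<open>regret_minimum_attained\<close>.\<close>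

definition regret ::
  "real \<Rightarrow> real ^ 'n::finite ^ 'm::finite \<Rightarrow> (nat \<Rightarrow> real ^ 'm) \<Rightarrow> (nat \<Rightarrow> real ^ 'n) \<Rightarrow> nat \<Rightarrow> real" where
  "regret \<tau> A \<mu> \<nu> T =
     (\<Sum>t=0..T. reg_loss \<tau> A (\<mu> t) (\<nu> t))
     - (INF x\<in>prob_simplex. \<Sum>t=0..T. reg_loss \<tau> A (\<mu> t) x)"

lemma continuous_on_x_ln_x: "continuous_on {0..} (\<lambda>x::real. x * ln x)"
proof -
  have "continuous (at x within {0..}) (\<lambda>x::real. x * ln x)" if "x \<ge> 0" for x :: real
  proof (cases "x = 0")
    case True
    have "((\<lambda>x::real. x * ln x) \<longlongrightarrow> 0) (at_right 0)"
      by real_asymp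
    moreover have "at 0 within {0..} = at_right (0::real)"
      using at_within_Ici_at_right by blast
    ultimately show ?thesis
      using True by (simp add: continuous_within)
  next
    case False
    with that have "isCont (\<lambda>x::real. x * ln x) x"
      by (intro continuous_intros) auto
    then show ?thesis
      by (rule continuous_at_imp_continuous_within)
  qed
  then show ?thesis
    by (simp add: continuous_on_eq_continuous_within)
qed

lemma prob_simplex_nonempty: "(prob_simplex :: (real ^ 'k::finite) set) \<noteq> {}"
proof -
  have "(\<chi> i. 1 / real CARD('k)) \<in> (prob_simplex :: (real ^ 'k) set)"
    by (simp add: prob_simplex_def)
  then show ?thesis by blast
qed

lemma compact_prob_simplex: "compact (prob_simplex :: (real ^ 'k::finite) set)"
proof -
  have "prob_simplex = (\<Inter>i. {x. 0 \<le> x $ i}) \<inter> {x :: real ^ 'k. (\<Sum>i\<in>UNIV. x $ i) = 1}"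
    by (auto simp: prob_simplex_def)
  moreover have "closed ((\<Inter>i. {x. 0 \<le> x $ i}) \<inter> {x :: real ^ 'k. (\<Sum>i\<in>UNIV. x $ i) = 1})"
    by (intro closed_Int closed_INT ballI closed_Collect_le closed_Collect_eq continuous_intros)
  moreover have "norm x \<le> 1" if "x \<in> prob_simplex" for x :: "real ^ 'k"
    using norm_le_l1_cart[of x] that by (simp add: prob_simplex_def)
  ultimately show ?thesis
    by (metis bounded_iff compact_eq_bounded_closed)
qed

lemma continuous_on_shannon_entropy: "continuous_on prob_simplex shannon_entropy"
proof -
  have "continuous_on prob_simplex (\<lambda>x :: real ^ 'k. x $ i * ln (x $ i))" for i
    by (rule continuous_on_compose2[OF continuous_on_x_ln_x])
      (auto simp: prob_simplex_def intro!: continuous_intros)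
  then show ?thesis
    unfolding shannon_entropy_def by (intro continuous_on_minus continuous_on_sum)
qed

lemma regret_minimum_attained:
  fixes A :: "real ^ 'n::finite ^ 'm::finite" and \<mu> :: "nat \<Rightarrow> real ^ 'm"
  shows "\<exists>x\<in>prob_simplex.
    (INF y\<in>prob_simplex. \<Sum>t=0..T. reg_loss \<tau> A (\<mu> t) y) = (\<Sum>t=0..T. reg_loss \<tau> A (\<mu> t) x) \<and>
    (\<forall>y\<in>prob_simplex. (\<Sum>t=0..T. reg_loss \<tau> A (\<mu> t) x) \<le> (\<Sum>t=0..T. reg_loss \<tau> A (\<mu> t) y))"
proof -
  let ?F = "\<lambda>y. \<Sum>t=0..T. reg_loss \<tau> A (\<mu> t) y"
  have "continuous_on prob_simplex ?F"
    unfolding reg_loss_def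
    by (intro continuous_intros continuous_on_shannon_entropy
        linear_continuous_on matrix_vector_mul_bounded_linear)
  then obtain x where x: "x \<in> prob_simplex" and le: "\<forall>y\<in>prob_simplex. ?F x \<le> ?F y"
    using continuous_attains_inf[OF compact_prob_simplex prob_simplex_nonempty] by blast
  have "(INF y\<in>prob_simplex. ?F y) = ?F x"
    using x le by (intro cInf_eq_minimum) auto
  with x le show ?thesis by blast
qed

end

theory Submission
  imports Defs
begin

text \<open>
  With \<open>\<eta>\<^sub>t \<tau> = 1 / (t + 1)\<close> the recursion telescopes in the logits: \<open>\<nu>\<^sub>t\<close> is the softmax of
  \<open>-(g\<^sub>1 + \<dots> + g\<^sub>t) / (t \<tau>)\<close> with \<open>g\<^sub>s = A\<^sup>T \<mu>\<^sub>s\<close>, the minimiser of the cumulative regularised loss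
  of the rounds \<open>1, \<dots>, t\<close>, while the iterate \<open>\<nu>\<close>-bar at time \<open>t\<close> has \<open>g\<^sub>t\<close> replaced by the
  prediction \<open>g\<^bsub>t-1\<^esub>\<close>. By the be-the-leader inequality, the regret of the rounds \<open>t \<ge> 1\<close> is at
  most the sum of the loss gaps between the two iterates. Their logits differ by
  \<open>O(M / (t \<tau>))\<close>, where \<open>M\<close> is the largest absolute value of an entry of \<open>A\<close>, and
  the gradient of the loss at \<open>\<nu>\<close>-bar is \<open>O(M)\<close> up to an additive constant because the logits are
  averages, so round \<open>t\<close> costs \<open>O(M\<^sup>2 / (t \<tau>))\<close>; the harmonic sum gives the logarithm.
\<close>

section \<open>Softmax and its logits\<close>

definition softmax :: "('k::finite \<Rightarrow> real) \<Rightarrow> real ^ 'k" where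
  "softmax u = normalize_weights (\<lambda>i. exp (u i))"

lemma sum_exp_pos: "(\<Sum>i\<in>UNIV. exp (u (i::'k::finite))) > (0::real)"
  by (intro sum_pos) auto

lemma softmax_nth: "softmax u $ i = exp (u i) / (\<Sum>j\<in>UNIV. exp (u j))"
  by (simp add: softmax_def normalize_weights_def)

lemma softmax_pos: "softmax u $ i > 0"
  by (simp add: softmax_nth sum_exp_pos)

lemma softmax_in_simplex: "softmax u \<in> prob_simplex"
  using sum_exp_pos[of u]
  by (auto simp: prob_simplex_def softmax_pos less_imp_le)
    (simp add: softmax_nth flip: sum_divide_distrib)

lemma ln_softmax: "ln (softmax u $ i) = u i - ln (\<Sum>j\<in>UNIV. exp (u j))"
  using sum_exp_pos[of u] by (simp add: softmax_nth ln_div)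

lemma normalize_weights_scale:
  assumes "c \<noteq> 0"
  shows "normalize_weights (\<lambda>i. c * w i) = normalize_weights w"
  using assms by (simp add: normalize_weights_def flip: sum_distrib_left)

text \<open>Makes each update affine in the logits: the power of the partition function is a factor
  common to all coordinates, and normalization cancels it.\<close>

lemma normalize_weights_softmax_powr:
  "normalize_weights (\<lambda>i. (softmax u $ i) powr c * exp (v i)) = softmax (\<lambda>i. c * u i + v i)"
proof -
  define Z where "Z = (\<Sum>j\<in>UNIV. exp (u j))"
  have "(softmax u $ i) powr c * exp (v i) = exp (- c * ln Z) * exp (c * u i + v i)" for i
    using softmax_pos[of u i]
    by (simp add: powr_def ln_softmax Z_def flip: exp_add) (simp add: algebra_simps)
  then show ?thesis
    by (simp add: normalize_weights_scale softmax_def)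
qed

lemma uniform_eq_softmax: "(\<chi> b. 1 / real CARD('k)) = (softmax (\<lambda>_. 0) :: real ^ 'k::finite)"
  by (simp add: vec_eq_iff softmax_nth)

section \<open>Entropy-regularized linear losses on the simplex\<close>

lemma gibbs_inequality:
  assumes x: "x \<in> prob_simplex" and p: "p \<in> prob_simplex" "\<And>i. p $ i > 0"
  shows "(\<Sum>i\<in>UNIV. x $ i * ln (p $ i)) \<le> (\<Sum>i\<in>UNIV. x $ i * ln (x $ i))"
proof -
  \<comment> \<open>This is \<open>ln z \<le> z - 1\<close> at \<open>z = p $ i / x $ i\<close>; the
    corrections \<open>p $ i - x $ i\<close> sum to zero over the simplex.\<close>
  have "x $ i * ln (p $ i) \<le> x $ i * ln (x $ i) + (p $ i - x $ i)" for i
  proof (cases "x $ i = 0")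
    case True
    then show ?thesis using p(2)[of i] by simp
  next
    case False
    then have pos: "x $ i > 0" using x by (simp add: prob_simplex_def order_less_le)
    then have "ln (p $ i) - ln (x $ i) \<le> p $ i / x $ i - 1"
      using ln_le_minus_one[of "p $ i / x $ i"] p(2)[of i] by (simp add: ln_div)
    then have "x $ i * (ln (p $ i) - ln (x $ i)) \<le> x $ i * (p $ i / x $ i - 1)"
      using pos by (intro mult_left_mono) auto
    then show ?thesis using pos by (simp add: algebra_simps)
  qed
  then have "(\<Sum>i\<in>UNIV. x $ i * ln (p $ i))
      \<le> (\<Sum>i\<in>UNIV. x $ i * ln (x $ i) + (p $ i - x $ i))"
    by (intro sum_mono)
  then show ?thesis
    using x p(1) by (simp add: sum.distrib sum_subtractf prob_simplex_def)
qed

definition ent_loss :: "real \<Rightarrow> ('k::finite \<Rightarrow> real) \<Rightarrow> real ^ 'k \<Rightarrow> real" where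
  "ent_loss c g x = (\<Sum>i\<in>UNIV. g i * x $ i) + c * (\<Sum>i\<in>UNIV. x $ i * ln (x $ i))"

text \<open>Gibbs variational principle: on the simplex this loss is, up to a constant,
  \<open>c\<close> times the relative entropy of \<open>x\<close> with respect to
  \<open>softmax u\<close>.\<close>

lemma softmax_minimizes_ent_loss:
  assumes x: "x \<in> prob_simplex" and c: "c \<ge> 0" and g: "\<And>i. g i = - c * u i"
  shows "ent_loss c g (softmax u) \<le> ent_loss c g x"
proof -
  define L where "L = ln (\<Sum>j\<in>UNIV. exp (u j))"
  have lin: "(\<Sum>i\<in>UNIV. y $ i * ln (softmax u $ i)) = (\<Sum>i\<in>UNIV. u i * y $ i) - L"
    if "y \<in> prob_simplex" for y
    using that
    by (simp add: ln_softmax L_def prob_simplex_def right_diff_distrib sum_subtractf mult.commute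
        flip: sum_distrib_right sum_distrib_left)
  have g_sum: "(\<Sum>i\<in>UNIV. g i * y $ i) = - c * (\<Sum>i\<in>UNIV. u i * y $ i)" for y :: "real ^ 'a"
    by (simp add: g sum_distrib_left mult.assoc)
  have "c * ((\<Sum>i\<in>UNIV. u i * x $ i) - L) \<le> c * (\<Sum>i\<in>UNIV. x $ i * ln (x $ i))"
    using gibbs_inequality[OF x softmax_in_simplex softmax_pos, of u] c lin[OF x]
    by (intro mult_left_mono) auto
  then show ?thesis
    by (simp add: ent_loss_def g_sum lin[OF softmax_in_simplex] algebra_simps)
qed

text \<open>Numerator and partition function each change by a factor of at most
  \<open>exp d\<close>, so the ratio of the entries is at least \<open>exp (- 2 * d)\<close>, which
  is at least \<open>1 - 2 * d\<close>.\<close>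

lemma softmax_diff_le:
  assumes d: "\<And>i. \<bar>u i - v i\<bar> \<le> d"
  shows "softmax u $ i - softmax v $ i \<le> 2 * d * softmax u $ i"
proof -
  have "(\<Sum>j\<in>UNIV. exp (v j)) \<le> (\<Sum>j\<in>UNIV. exp d * exp (u j))"
  proof (rule sum_mono)
    fix j
    show "exp (v j) \<le> exp d * exp (u j)" using d[of j] by (simp flip: exp_add)
  qed
  then have "ln (\<Sum>j\<in>UNIV. exp (v j)) \<le> ln (exp d * (\<Sum>j\<in>UNIV. exp (u j)))"
    using sum_exp_pos[of u] sum_exp_pos[of v] by (simp add: sum_distrib_left)
  also have "\<dots> = d + ln (\<Sum>j\<in>UNIV. exp (u j))"
    using sum_exp_pos[of u] by (simp add: ln_mult)
  finally have "ln (softmax u $ i) - 2 * d \<le> ln (softmax v $ i)"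
    using d[of i] by (simp add: ln_softmax)
  then have "exp (ln (softmax u $ i) - 2 * d) \<le> softmax v $ i"
    using softmax_pos[of v i] by (metis exp_le_cancel_iff exp_ln)
  then have "softmax u $ i * exp (- 2 * d) \<le> softmax v $ i"
    using softmax_pos[of u i] by (simp add: exp_diff exp_minus divide_inverse)
  moreover have "softmax u $ i * (1 - 2 * d) \<le> softmax u $ i * exp (- 2 * d)"
    using softmax_pos[of u i] exp_ge_add_one_self[of "- 2 * d"] by (intro mult_left_mono) auto
  ultimately show ?thesis by (simp add: algebra_simps)
qed

lemma softmax_l1_le:
  assumes d: "\<And>i. \<bar>u i - v i\<bar> \<le> d"
  shows "(\<Sum>i\<in>UNIV. \<bar>softmax u $ i - softmax v $ i\<bar>) \<le> 4 * d"
proof -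
  have d': "\<And>i. \<bar>v i - u i\<bar> \<le> d" using d by (simp add: abs_minus_commute)
  have "0 \<le> d" using d[of undefined] by linarith
  then have "\<bar>softmax u $ i - softmax v $ i\<bar> \<le> 2 * d * (softmax u $ i + softmax v $ i)" for i
    using softmax_diff_le[of u v d, OF d, of i] softmax_diff_le[of v u d, OF d', of i]
      mult_nonneg_nonneg[of "2 * d" "softmax u $ i"] mult_nonneg_nonneg[of "2 * d" "softmax v $ i"]
      softmax_pos[of u i] softmax_pos[of v i]
    unfolding distrib_left by linarith
  then have "(\<Sum>i\<in>UNIV. \<bar>softmax u $ i - softmax v $ i\<bar>)
      \<le> (\<Sum>i\<in>UNIV. 2 * d * (softmax u $ i + softmax v $ i))"
    by (intro sum_mono)
  also have "\<dots> = 4 * d"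
    using softmax_in_simplex[of u] softmax_in_simplex[of v]
    by (simp add: sum.distrib prob_simplex_def flip: sum_distrib_left)
  finally show ?thesis .
qed

text \<open>The entropy has unbounded gradient on the simplex, but at \<open>softmax u\<close> it
  contributes only \<open>c * u i\<close> plus a constant, so bounded logits suffice for a Lipschitz
  estimate.\<close>

lemma ent_loss_softmax_diff_le:
  assumes c: "c > 0" and g: "\<And>i. \<bar>g i\<bar> \<le> M" and u: "\<And>i. \<bar>u i\<bar> \<le> M / c"
    and d: "\<And>i. \<bar>u i - v i\<bar> \<le> d"
  shows "ent_loss c g (softmax u) - ent_loss c g (softmax v) \<le> 8 * M * d"
proof -
  define p q where "p = softmax u" and "q = softmax v"
  define h where "h i = g i + c * u i" for i
  have h: "\<bar>h i\<bar> \<le> 2 * M" for i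
  proof -
    have "\<bar>c * u i\<bar> \<le> M" using u[of i] c by (simp add: abs_mult field_simps)
    then show ?thesis unfolding h_def using g[of i] by linarith
  qed
  have ent_split: "ent_loss c g y = (\<Sum>i\<in>UNIV. h i * y $ i) + ent_loss c (\<lambda>i. - c * u i) y" for y
    by (simp add: ent_loss_def h_def distrib_right sum.distrib sum_negf)
  \<comment> \<open>Convexity of the loss at \<open>p\<close>: the part of the loss minimised by \<open>p\<close> can be dropped.\<close>
  have "ent_loss c g p - ent_loss c g q \<le> (\<Sum>i\<in>UNIV. h i * p $ i) - (\<Sum>i\<in>UNIV. h i * q $ i)"
    using softmax_minimizes_ent_loss[of q c "\<lambda>i. - c * u i" u] c
    by (simp add: ent_split p_def q_def softmax_in_simplex)
  also have "\<dots> = (\<Sum>i\<in>UNIV. h i * (p $ i - q $ i))"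
    by (simp add: right_diff_distrib sum_subtractf)
  also have "\<dots> \<le> (\<Sum>i\<in>UNIV. 2 * M * \<bar>p $ i - q $ i\<bar>)"
  proof (rule sum_mono)
    fix i
    have "h i * (p $ i - q $ i) \<le> \<bar>h i\<bar> * \<bar>p $ i - q $ i\<bar>"
      by (metis abs_ge_self abs_mult)
    also have "\<dots> \<le> 2 * M * \<bar>p $ i - q $ i\<bar>"
      using h by (intro mult_right_mono) auto
    finally show "h i * (p $ i - q $ i) \<le> 2 * M * \<bar>p $ i - q $ i\<bar>" .
  qed
  also have "\<dots> \<le> 2 * M * (4 * d)"
  proof -
    have "0 \<le> M" using g[of undefined] by linarith
    then show ?thesis
      using mult_left_mono[OF softmax_l1_le[of u v, OF d], of "2 * M"]
      by (simp add: p_def q_def sum_distrib_left)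
  qed
  finally show ?thesis by (simp add: p_def q_def)
qed

lemma be_the_leader:
  fixes f :: "nat \<Rightarrow> 'a \<Rightarrow> real"
  assumes "\<And>t y. 1 \<le> t \<Longrightarrow> y \<in> X \<Longrightarrow> (\<Sum>s=1..t. f s (p t)) \<le> (\<Sum>s=1..t. f s y)"
    and "\<And>t. p t \<in> X" and "x \<in> X"
  shows "(\<Sum>t=1..T. f t (p t)) \<le> (\<Sum>t=1..T. f t x)"
  using \<open>x \<in> X\<close>
proof (induction T arbitrary: x)
  case (Suc T)
  have "(\<Sum>t=1..Suc T. f t (p t)) \<le> (\<Sum>t=1..Suc T. f t (p (Suc T)))"
    \<comment> \<open>The comparator of the first \<open>T\<close> rounds is the next
      leader.\<close>
    using Suc.IH[OF assms(2)[of "Suc T"]] by simp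
  also have "\<dots> \<le> (\<Sum>t=1..Suc T. f t x)"
    by (rule assms(1)) (use Suc.prems in simp_all)
  finally show ?case .
qed simp

section \<open>From the matrix game to entropy-regularized losses\<close>

lemma abs_le_max_abs_entry:
  fixes A :: "real ^ 'n::finite ^ 'm::finite"
  shows "\<bar>A $ i $ j\<bar> \<le> max_abs_entry A"
proof -
  have "{\<bar>A $ i $ j\<bar> | i j. True} = (\<lambda>(i, j). \<bar>A $ i $ j\<bar>) ` UNIV" by auto
  then have "finite {\<bar>A $ i $ j\<bar> | i j. True}" by simp
  then show ?thesis unfolding max_abs_entry_def by (rule Max_ge) auto
qed

lemma abs_sum_mult_simplex_le:
  assumes x: "x \<in> prob_simplex" and g: "\<And>i. \<bar>g i\<bar> \<le> M"
  shows "\<bar>\<Sum>i\<in>UNIV. g i * x $ i\<bar> \<le> M"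
proof -
  have "\<bar>\<Sum>i\<in>UNIV. g i * x $ i\<bar> \<le> (\<Sum>i\<in>UNIV. M * x $ i)"
    using x g by (intro order_trans[OF sum_abs] sum_mono)
      (auto simp: abs_mult prob_simplex_def intro!: mult_right_mono)
  also have "\<dots> = M" using x by (simp add: prob_simplex_def flip: sum_distrib_left)
  finally show ?thesis .
qed

lemma abs_transpose_mult_simplex_le:
  assumes "\<mu> \<in> prob_simplex"
  shows "\<bar>(transpose A *v \<mu>) $ b\<bar> \<le> max_abs_entry A"
  using abs_sum_mult_simplex_le[OF assms, of "\<lambda>i. A $ i $ b" "max_abs_entry A"]
  by (simp add: matrix_vector_mult_def transpose_def abs_le_max_abs_entry)

lemma reg_loss_eq_ent_loss:
  "reg_loss \<tau> A \<mu> x = ent_loss \<tau> (\<lambda>b. (transpose A *v \<mu>) $ b) x + \<tau> * shannon_entropy \<mu>"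
proof -
  have "\<mu> \<bullet> (A *v x) = (transpose A *v \<mu>) \<bullet> x"
    by (simp add: dot_lmul_matrix)
  then show ?thesis
    by (simp add: reg_loss_def ent_loss_def shannon_entropy_def inner_vec_def)
qed

text \<open>Keeps cumulative losses in the same family, so that their minimizers are again softmax
  policies.\<close>

lemma sum_ent_loss:
  "(\<Sum>s\<in>S. ent_loss c (g s) x) = ent_loss (real (card S) * c) (\<lambda>i. \<Sum>s\<in>S. g s i) x"
proof -
  have "(\<Sum>s\<in>S. \<Sum>i\<in>UNIV. g s i * x $ i) = (\<Sum>i\<in>UNIV. (\<Sum>s\<in>S. g s i) * x $ i)"
    by (subst sum.swap) (simp add: sum_distrib_right)
  then show ?thesis by (simp add: ent_loss_def sum.distrib)
qed

theorem theorem2: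
  fixes A :: "real ^ 'n::finite ^ 'm::finite"
    and \<tau> :: real
    and \<eta> :: "nat \<Rightarrow> real"
    and mubar :: "nat \<Rightarrow> real ^ 'm"
    and nu nubar :: "nat \<Rightarrow> real ^ 'n"
    and T :: nat
  assumes "\<tau> > 0"
    and "\<And>t. mubar t \<in> prob_simplex"
    and "\<And>t. \<eta> t = 1 / ((real t + 1) * \<tau>)"
    and "nu 0 = (\<chi> b. 1 / real CARD('n))"
    and "nubar 0 = (\<chi> b. 1 / real CARD('n))"
    and "\<And>t. nubar (Suc t) = normalize_weights
          (\<lambda>b. (nu t $ b) powr (1 - \<eta> t * \<tau>) * exp (- \<eta> t * (transpose A *v mubar t) $ b))"
    and "\<And>t. nu (Suc t) = normalize_weights
          (\<lambda>b. (nu t $ b) powr (1 - \<eta> t * \<tau>) * exp (- \<eta> t * (transpose A *v mubar (Suc t)) $ b))"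
    and "T \<ge> 1"
  shows "regret \<tau> A mubar nubar T
    \<le> inverse \<tau> * (ln (real T) + 1) * (\<tau> * ln (real CARD('n)) + 5 * max_abs_entry A)\<^sup>2
       + 4 * max_abs_entry A"
proof -
  define M where "M = max_abs_entry A"
  define g where "g t b = (transpose A *v mubar t) $ b" for t b
  define f where "f t = ent_loss \<tau> (g t)" for t
  \<comment> \<open>For \<open>t = 0\<close> the division by zero gives the zero logits of the uniform policy.\<close>
  define u where "u t b = - (\<Sum>s=1..t. g s b) / (real t * \<tau>)" for t b
  \<comment> \<open>At \<open>t = 1\<close> the sum is empty and the prediction is
    \<open>g 0\<close>, which never enters \<open>u\<close>.\<close>
  define v where "v t b = - ((\<Sum>s=1..<t. g s b) + g (t - 1) b) / (real t * \<tau>)" for t b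
  note \<tau> = assms(1)
  have g: "\<bar>g t b\<bar> \<le> M" for t b
    unfolding g_def M_def by (rule abs_transpose_mult_simplex_le) (rule assms(2))
  have M: "0 \<le> M" using g[of 0 undefined] by linarith
  have \<eta>: "1 - \<eta> t * \<tau> = real t / real (Suc t)" "\<eta> t = 1 / (real (Suc t) * \<tau>)" for t
    using \<tau> by (simp_all add: assms(3) divide_simps add.commute)
  \<comment> \<open>Here \<open>x\<close> stands for the newest loss vector:
    \<open>g (Suc t) b\<close> leads to \<open>u\<close>, the prediction \<open>g t b\<close> to
    \<open>v\<close>.\<close>
  have scale: "(1 - \<eta> t * \<tau>) * u t b + - \<eta> t * x = - ((\<Sum>s=1..t. g s b) + x) / (real (Suc t) * \<tau>)"
    for t b x
  proof -
    have "(1 - \<eta> t * \<tau>) * u t b = - (\<Sum>s=1..t. g s b) / (real (Suc t) * \<tau>)"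
      unfolding \<eta>(1) u_def by (cases "t = 0") (simp_all del: of_nat_Suc)
    then show ?thesis unfolding \<eta>(2) by (simp add: diff_divide_distrib)
  qed
  have nu: "nu t = softmax (u t)" for t
  proof (induction t)
    case 0
    then show ?case by (simp add: assms(4) uniform_eq_softmax u_def)
  next
    case (Suc t)
    show ?case
      unfolding assms(7) Suc normalize_weights_softmax_powr scale
      by (simp add: u_def g_def)
  qed
  have nubar: "nubar t = softmax (v t)" if "1 \<le> t" for t
  proof -
    obtain k where k: "t = Suc k" using \<open>1 \<le> t\<close> by (cases t) auto
    show ?thesis
      unfolding k assms(6) nu normalize_weights_softmax_powr scale
      by (simp add: v_def[abs_def] g_def atLeastLessThanSuc_atLeastAtMost)
  qed

  have round: "f t (nubar t) - f t (nu t) \<le> inverse (real t) * (16 * M\<^sup>2 / \<tau>)" if t: "1 \<le> t" for t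
  proof -
    have t\<tau>: "real t * \<tau> > 0" using t \<tau> by simp
    have "\<bar>v t b\<bar> \<le> M / \<tau>" for b
    proof -
      have "\<bar>\<Sum>s=1..<t. g s b\<bar> \<le> (\<Sum>s=1..<t. M)"
        using g by (intro order_trans[OF sum_abs] sum_mono) auto
      then have "\<bar>(\<Sum>s=1..<t. g s b) + g (t - 1) b\<bar> \<le> real t * M"
        using g[of "t - 1" b] t by (simp add: of_nat_diff algebra_simps)
      then have "\<bar>v t b\<bar> \<le> real t * M / (real t * \<tau>)"
        unfolding v_def abs_divide abs_minus_cancel abs_of_pos[OF t\<tau>] using t\<tau>
        by (intro divide_right_mono) auto
      then show ?thesis using t by simp
    qed
    moreover have "\<bar>v t b - u t b\<bar> \<le> 2 * M / (real t * \<tau>)" for b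
    proof -
      have "{1..t} = insert t {1..<t}" using t by auto
      then have "v t b - u t b = (g t b - g (t - 1) b) / (real t * \<tau>)"
        by (simp add: u_def v_def flip: diff_divide_distrib)
      moreover have "\<bar>g t b - g (t - 1) b\<bar> \<le> 2 * M"
        using g[of t b] g[of "t - 1" b] by linarith
      ultimately show ?thesis using t\<tau> by (simp add: divide_right_mono)
    qed
    \<comment> \<open>The gap \<open>d = 2 * M / (real t * \<tau>)\<close> between the logits yields
      the constant \<open>16 = 8 * 2\<close>.\<close>
    ultimately have "f t (nubar t) - f t (nu t) \<le> 8 * M * (2 * M / (real t * \<tau>))"
      unfolding f_def nu nubar[OF t] using g \<tau> by (intro ent_loss_softmax_diff_le)
    then show ?thesis by (simp add: power2_eq_square field_simps)
  qed

  obtain x where x: "x \<in> prob_simplex"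
    and min: "(INF y\<in>prob_simplex. \<Sum>t=0..T. reg_loss \<tau> A (mubar t) y)
      = (\<Sum>t=0..T. reg_loss \<tau> A (mubar t) x)"
    using regret_minimum_attained[where A = A and \<tau> = \<tau> and \<mu> = mubar and T = T] by blast
  have regret: "regret \<tau> A mubar nubar T = (\<Sum>t=0..T. f t (nubar t)) - (\<Sum>t=0..T. f t x)"
    unfolding regret_def min
    by (simp add: reg_loss_eq_ent_loss f_def g_def[abs_def] sum.distrib)
  \<comment> \<open>Round 0 lies outside the leader argument. The uniform policy maximizes entropy,
    so only the linear part costs, at most \<open>M\<close> for each of the two policies.\<close>
  have first: "f 0 (nubar 0) - f 0 x \<le> 2 * M"
  proof -
    have nubar0: "nubar 0 = softmax (\<lambda>_. 0)" by (simp add: assms(5) uniform_eq_softmax)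
    have "ent_loss \<tau> (\<lambda>_. 0) (nubar 0) \<le> ent_loss \<tau> (\<lambda>_. 0) x"
      unfolding nubar0 using x \<tau> by (intro softmax_minimizes_ent_loss) auto
    moreover have "\<bar>\<Sum>i\<in>UNIV. g 0 i * nubar 0 $ i\<bar> \<le> M"
      using g nubar0 softmax_in_simplex by (intro abs_sum_mult_simplex_le) auto
    moreover have "\<bar>\<Sum>i\<in>UNIV. g 0 i * x $ i\<bar> \<le> M"
      using g x by (intro abs_sum_mult_simplex_le) auto
    ultimately show ?thesis unfolding f_def ent_loss_def by simp
  qed
  have leader: "(\<Sum>t=1..T. f t (nu t)) \<le> (\<Sum>t=1..T. f t x)"
  proof (rule be_the_leader[OF _ _ x])
    fix t :: nat and y :: "real ^ 'n" assume "1 \<le> t" "y \<in> prob_simplex"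
    then show "(\<Sum>s=1..t. f s (nu t)) \<le> (\<Sum>s=1..t. f s y)"
      unfolding f_def sum_ent_loss nu using \<tau>
      by (intro softmax_minimizes_ent_loss) (auto simp: u_def)
  qed (simp add: nu softmax_in_simplex)

  have "regret \<tau> A mubar nubar T
      = (f 0 (nubar 0) - f 0 x) + ((\<Sum>t=1..T. f t (nubar t)) - (\<Sum>t=1..T. f t x))"
    unfolding regret by (simp add: sum.atLeast_Suc_atMost)
  also have "\<dots> \<le> 2 * M + (\<Sum>t=1..T. f t (nubar t) - f t (nu t))"
    using first leader by (simp add: sum_subtractf)
  also have "\<dots> \<le> 2 * M + (\<Sum>t=1..T. inverse (real t) * (16 * M\<^sup>2 / \<tau>))"
    using round by (intro add_left_mono sum_mono) auto
  also have "\<dots> = 2 * M + harm T * (16 * M\<^sup>2 / \<tau>)"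
    by (simp only: harm_def sum_distrib_right)
  \<comment> \<open>There is slack here: \<open>16 \<le> 5\<^sup>2\<close> and
    \<open>2 * M \<le> 4 * M\<close>. The harmonic bound holds because \<open>harm n - ln n\<close>
    decreases from its value 1 at \<open>n = 1\<close>.\<close>
  also have "\<dots> \<le> 4 * M + (ln (real T) + 1) * ((\<tau> * ln (real CARD('n)) + 5 * M)\<^sup>2 / \<tau>)"
  proof -
    have "0 \<le> \<tau> * ln (real CARD('n))" using \<tau> by (simp add: Suc_le_eq)
    then have "(5 * M)\<^sup>2 \<le> (\<tau> * ln (real CARD('n)) + 5 * M)\<^sup>2"
      using M by (intro power_mono) auto
    moreover have "16 * M\<^sup>2 \<le> (5 * M)\<^sup>2" by (simp add: power2_eq_square)
    ultimately have "16 * M\<^sup>2 / \<tau> \<le> (\<tau> * ln (real CARD('n)) + 5 * M)\<^sup>2 / \<tau>"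
      using \<tau> by (intro divide_right_mono) linarith+
    moreover have "harm T \<le> ln (real T) + 1" "0 \<le> ln (real T) + 1"
      using assms(8) euler_mascheroni_sequence_decreasing[of 1 T] by (auto simp: harm_expand)
    ultimately have "harm T * (16 * M\<^sup>2 / \<tau>)
        \<le> (ln (real T) + 1) * ((\<tau> * ln (real CARD('n)) + 5 * M)\<^sup>2 / \<tau>)"
      using \<tau> by (intro mult_mono) auto
    then show ?thesis using M by simp
  qed
  finally show ?thesis
    by (simp add: M_def divide_inverse mult_ac add.commute)
qed

end
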